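(* Let $m\geq 1$ be an integer, let $\boldsymbol{\eta}=(\eta_1,\dots,\eta_m)\in(\mathbb{F}_3^* )^m$ with $\eta_m=(-1)^{m-1}$, and let $\mathbf{k}=(k_1,\dots,k_m)\in\mathbb{N}^m$ with $k_1\geq 2$ and $k_{i+1}-k_i\geq 2$ for $i=1,\dots,m-1$. Define the integers $$t_{i,n}=k_m\frac{3^n-1}{2}+k_i3^n\qquad\text{for }1\leq i\leq m\text{ and }n\geq 0.$$ Define two sequences $(\lambda_t)_{t\geq 1}$ and $(\mu_t)_{t\geq 1}$ in $\mathbb{F}_3$ as follows. For $n\geq 0$, $$\lambda_t=\begin{cases}1&\text{if }1\leq t\leq t_{1,0},\\(-1)^{mn+i}&\text{if }t_{i,n}<t\leq t_{i+1,n}\text{ for some }1\leq i<m,\\(-1)^{m(n+1)}&\text{if }t_{m,n}<t\leq t_{1,n+1}.\end{cases}$$ Also $\mu_1=1$ and, for $t>1$, $$\mu_t=\begin{cases}(-1)^{n(m+1)}\eta_i&\text{if }t=t_{i,n}\text{ or }t=t_{i,n}+1\text{ for some }n\geq 0,\ 1\leq i\leq m,\\0&\text{otherwise.}\end{cases}$$ Let $\omega(m,\boldsymbol{\eta},\mathbf{k})\in\mathbb{F}(3)$ be defined by the infinite continued fraction expansion $$\omega(m,\boldsymbol{\eta},\mathbf{k})=[a_1,a_2,\dots,a_n,\dots]\quad\text{where } a_n=\lambda_nT+\mu_n .$$ Set $l=1+k_m$, and let $(x_n)_{n\geq 0}$ and $(y_n)_{n\geq 0}$ be the numerators and denominators of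 the convergents to $\omega(m,\boldsymbol{\eta},\mathbf{k})$ (the continuants). Then $\omega(m,\boldsymbol{\eta},\mathbf{k})$ is the unique root in $\mathbb{F}(3)^+$ of the quartic equation $$X=\frac{x_lX^3+(-1)^{m-1}x_{l-3}}{y_lX^3+(-1)^{m-1}y_{l-3}}.$$
   Context: $\mathbb{F}_3$ is the field with 3 elements and $T$ is an indeterminate. $\mathbb{F}(3)=\mathbb{F}_3((T^{-1}))$ is the field of formal power series in $1/T$ over $\mathbb{F}_3$: a nonzero element is $\alpha=\sum_{k\leq k_0}u_kT^k$ with $k_0\in\mathbb{Z}$, $u_k\in\mathbb{F}_3$, $u_{k_0}\neq 0$, and its absolute value is $|\alpha|=|T|^{k_0}$, where $|T|>1$ is a fixed real number (and $|0|=0$). $\mathbb{F}(3)^+$ is the set of $\alpha\in\mathbb{F}(3)$ with $|\alpha|>1$. Every irrational $\alpha\in\mathbb{F}(3)^+$ has an infinite continued fraction expansion $\alpha=[a_1,a_2,\dots]=a_1+1/(a_2+1/(a_3+\cdots))$ with $a_i\in\mathbb{F}_3[T]$ and $\deg a_i>0$ for $i\geq 1$; conversely every such sequence of partial quotients defines an element of $\mathbb{F}(3)^+$. The continuants $(x_n)_{n\geq 0}$ and $(y_n)_{n\geq 0}$ are polynomials both satisfying $K_n=a_nK_{n-1}+K_{n-2}$ for $n\geq 2$, with initial conditions $x_0=1$, $x_1=a_1$ and $y_0=0$, $y_1=1$; the convergents are $x_n/y_n$ for $n\geq 1$. Signs $\pm 1$ are read in $\mathbb{F}_3$ where appropriate.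 *)

theory Defs
  imports "HOL-Computational_Algebra.Computational_Algebra" "HOL-Library.Cardinality"
begin

text \<open>
  The field of formal power series in \<open>1/T\<close> over a field \<open>'a\<close> is rendered as \<^typ>\<open>'a fls\<close>: the
  uniformizer \<^term>\<open>fls_X\<close> plays the role of \<open>1/T\<close>, hence \<open>T\<close> is \<^term>\<open>fls_X_inv\<close>, and
  the highest exponent of \<open>T\<close> occurring in a nonzero \<open>\<alpha>\<close> is \<open>- fls_subdegree \<alpha>\<close>.
  Polynomials in \<open>T\<close> are embedded by evaluation at \<^term>\<open>fls_X_inv\<close>.
\<close>

definition poly_T :: "'a::field poly \<Rightarrow> 'a fls" where
  "poly_T p = poly (map_poly fls_const p) fls_X_inv"

text \<open>The parameter \<open>q > 1\<close> is the value chosen for \<open>|T|\<close>.\<close>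

definition abs_T :: "real \<Rightarrow> 'a::field fls \<Rightarrow> real" where
  "abs_T q \<alpha> = (if \<alpha> = 0 then 0 else q powi (- fls_subdegree \<alpha>))"

definition F_plus :: "real \<Rightarrow> 'a::field fls set" where
  "F_plus q = {\<alpha>. abs_T q \<alpha> > 1}"


text \<open>\<open>fin_cf a i n\<close> is the finite continued fraction \<open>[a\<^sub>i, \<dots>, a\<^bsub>i+n\<^esub>]\<close>.\<close>

fun fin_cf :: "(nat \<Rightarrow> 'a::field poly) \<Rightarrow> nat \<Rightarrow> nat \<Rightarrow> 'a fls" where
  "fin_cf a i 0 = poly_T (a i)"
| "fin_cf a i (Suc n) = poly_T (a i) + 1 / fin_cf a (Suc i) n"

text \<open>
  \<open>[a\<^sub>1, a\<^sub>2, \<dots>]\<close>, the limit taken in the library metric on \<^typ>\<open>'a fls\<close>, which is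
  the one given by the absolute value with \<open>|T| = 2\<close>.  All choices of \<open>|T| > 1\<close> induce the same
  topology.
\<close>

definition inf_cf :: "(nat \<Rightarrow> 'a::field poly) \<Rightarrow> 'a fls" where
  "inf_cf a = lim (\<lambda>n. fin_cf a 1 n)"

fun cont_x :: "(nat \<Rightarrow> 'a::field poly) \<Rightarrow> nat \<Rightarrow> 'a poly" where
  "cont_x a 0 = 1"
| "cont_x a (Suc 0) = a 1"
| "cont_x a (Suc (Suc n)) = a (Suc (Suc n)) * cont_x a (Suc n) + cont_x a n"

fun cont_y :: "(nat \<Rightarrow> 'a::field poly) \<Rightarrow> nat \<Rightarrow> 'a poly" where
  "cont_y a 0 = 0"
| "cont_y a (Suc 0) = 1"
| "cont_y a (Suc (Suc n)) = a (Suc (Suc n)) * cont_y a (Suc n) + cont_y a n"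


text \<open>
  Tuples \<open>(\<eta>\<^sub>1, \<dots>, \<eta>\<^sub>m)\<close> and \<open>(k\<^sub>1, \<dots>, k\<^sub>m)\<close> are functions on \<^typ>\<open>nat\<close> of which only the values
  at \<open>1, \<dots>, m\<close> are used.  The index 0 of the sequences \<open>lambda_seq\<close>, \<open>mu_seq\<close> and
  \<open>omega_pq\<close> is likewise unused.  The sign is uniquely determined in each definite description
  below because the \<open>t\<^bsub>i,n\<^esub>\<close>, ordered lexicographically by \<open>(n, i)\<close>, increase by steps of
  at least 2 as soon as \<open>k\<^sub>1 \<ge> 2\<close> and \<open>k\<^bsub>i+1\<^esub> - k\<^sub>i \<ge> 2\<close>.
\<close>

definition t_idx :: "nat \<Rightarrow> (nat \<Rightarrow> nat) \<Rightarrow> nat \<Rightarrow> nat \<Rightarrow> nat" where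
  "t_idx m k i n = k m * ((3 ^ n - 1) div 2) + k i * 3 ^ n"

definition lambda_seq :: "nat \<Rightarrow> (nat \<Rightarrow> nat) \<Rightarrow> nat \<Rightarrow> 'a::field" where
  "lambda_seq m k t =
    (if t \<le> t_idx m k 1 0 then 1
     else (THE c. \<exists>n.
       (\<exists>i. 1 \<le> i \<and> i < m \<and> t_idx m k i n < t \<and> t \<le> t_idx m k (i + 1) n
          \<and> c = (-1) ^ (m * n + i))
       \<or> (t_idx m k m n < t \<and> t \<le> t_idx m k 1 (n + 1) \<and> c = (-1) ^ (m * (n + 1)))))"

definition mu_seq :: "nat \<Rightarrow> (nat \<Rightarrow> 'a::field) \<Rightarrow> (nat \<Rightarrow> nat) \<Rightarrow> nat \<Rightarrow> 'a" where
  "mu_seq m \<eta> k t =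
    (if t = 1 then 1
     else if \<exists>n i. 1 \<le> i \<and> i \<le> m \<and> (t = t_idx m k i n \<or> t = t_idx m k i n + 1)
     then (THE c. \<exists>n i. 1 \<le> i \<and> i \<le> m \<and> (t = t_idx m k i n \<or> t = t_idx m k i n + 1)
             \<and> c = (-1) ^ (n * (m + 1)) * \<eta> i)
     else 0)"

definition omega_pq :: "nat \<Rightarrow> (nat \<Rightarrow> 'a::field) \<Rightarrow> (nat \<Rightarrow> nat) \<Rightarrow> nat \<Rightarrow> 'a poly" where
  "omega_pq m \<eta> k n = [:mu_seq m \<eta> k n, lambda_seq m k n:]"

definition omega :: "nat \<Rightarrow> (nat \<Rightarrow> 'a::field) \<Rightarrow> (nat \<Rightarrow> nat) \<Rightarrow> 'a fls" where
  "omega m \<eta> k = inf_cf (omega_pq m \<eta> k)"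

text \<open>
  The equation \<open>X = (x\<^sub>l X\<^sup>3 + (-1)\<^bsup>m-1\<^esup> x\<^bsub>l-3\<^esub>) / (y\<^sub>l X\<^sup>3 + (-1)\<^bsup>m-1\<^esup> y\<^bsub>l-3\<^esub>)\<close>.  A vanishing
  denominator would force \<open>X = 0\<close>, as \<open>x / 0 = 0\<close>, so no spurious solution arises in \<^const>\<open>F_plus\<close>.
\<close>

definition quartic_eq :: "nat \<Rightarrow> nat \<Rightarrow> (nat \<Rightarrow> 'a::field poly) \<Rightarrow> 'a fls \<Rightarrow> bool" where
  "quartic_eq m l a X \<longleftrightarrow>
    X = (poly_T (cont_x a l) * X ^ 3 + (-1) ^ (m - 1) * poly_T (cont_x a (l - 3)))
      / (poly_T (cont_y a l) * X ^ 3 + (-1) ^ (m - 1) * poly_T (cont_y a (l - 3)))"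

end

theory Submission
  imports Defs
begin

text \<open>
  Let \<open>\<alpha>\<^sub>n = [a\<^sub>n, a\<^bsub>n+1\<^esub>, \<dots>]\<close> be the complete quotients of \<open>\<omega>\<close> and \<open>c = (-1)\<^sup>m\<close>.  In characteristic 3 cubing
  is additive, and the partial quotients are built so that
  \<open>\<alpha>\<^sub>n\<^sup>3 = c (T\<^sup>2 + 1) \<alpha>\<^bsub>3n + l - 2\<^esub> + \<lambda>\<^sub>n T + f\<^sub>n\<close>
  for suitable constants \<open>f\<^sub>n\<close>: one partial quotient on the left matches three on the right, in accordance
  with \<open>t\<^bsub>i,n+1\<^esub> = 3 t\<^bsub>i,n\<^esub> + k\<^sub>m\<close>.  If this relation held up to a defect \<open>D\<^sub>n\<close>, then \<open>D\<^sub>n\<close> would be smaller than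
  \<open>D\<^bsub>n+1\<^esub>\<close> by the factor \<open>|T|\<^sup>-\<^sup>6\<close>; since all defects are bounded, they vanish.  For \<open>n = 1\<close> the relation
  expresses \<open>\<alpha>\<^bsub>l+1\<^esub>\<close> through \<open>\<omega>\<^sup>3\<close>, and because \<open>1 + a\<^bsub>l-1\<^esub> a\<^sub>l = -(T\<^sup>2 + 1)\<close> this is the quartic equation.

  Uniqueness: two roots \<open>X \<noteq> Y\<close> in \<open>F\<^sup>+\<close> have absolute value \<open>|T|\<close>, and subtracting their equations gives
  \<open>X - Y\<close> as a small multiple of \<open>(X - Y)\<^sup>3\<close>, so small that \<open>|X - Y|\<close> would have to exceed \<open>|T|\<close>.
\<close>


section \<open>Orders of Laurent series\<close>

text \<open>The order is taken in \<open>1/T\<close>: it is minus the degree in \<open>T\<close>, and zero has every order.\<close>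

definition ord_ge :: "int \<Rightarrow> 'a::field fls \<Rightarrow> bool" where
  "ord_ge n f \<longleftrightarrow> f = 0 \<or> n \<le> fls_subdegree f"

definition ord_eq :: "int \<Rightarrow> 'a::field fls \<Rightarrow> bool" where
  "ord_eq n f \<longleftrightarrow> f \<noteq> 0 \<and> fls_subdegree f = n"

lemma ord_ge_mono: "ord_ge n f \<Longrightarrow> m \<le> n \<Longrightarrow> ord_ge m f"
  by (auto simp: ord_ge_def)

lemma ord_eq_imp_ge: "ord_eq n f \<Longrightarrow> m \<le> n \<Longrightarrow> ord_ge m f"
  by (auto simp: ord_ge_def ord_eq_def)

lemma ord_ge_iff_nth: "ord_ge n f \<longleftrightarrow> (\<forall>i<n. fls_nth f i = 0)"
proof
  assume "ord_ge n f"
  then show "\<forall>i<n. fls_nth f i = 0"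
    by (auto simp: ord_ge_def)
next
  assume "\<forall>i<n. fls_nth f i = 0"
  then show "ord_ge n f"
    using fls_subdegree_geI[of f n] by (auto simp: ord_ge_def)
qed

lemma ord_ge_add: "ord_ge n f \<Longrightarrow> ord_ge n g \<Longrightarrow> ord_ge n (f + g)"
  by (simp add: ord_ge_iff_nth)

lemma ord_ge_diff: "ord_ge n f \<Longrightarrow> ord_ge n g \<Longrightarrow> ord_ge n (f - g)"
  by (simp add: ord_ge_iff_nth)

lemma ord_ge_uminus [simp]: "ord_ge n (- f) \<longleftrightarrow> ord_ge n f"
  by (simp add: ord_ge_iff_nth)

lemma ord_ge_minus_commute: "ord_ge n (f - g) \<Longrightarrow> ord_ge n (g - f)"
  using ord_ge_uminus[of n "f - g"] by simp

lemma ord_ge_mult: "ord_ge n f \<Longrightarrow> ord_ge m g \<Longrightarrow> ord_ge (n + m) (f * g)"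
  unfolding ord_ge_def by (cases "f = 0"; cases "g = 0") auto

lemma ord_eq_mult: "ord_eq n f \<Longrightarrow> ord_eq m g \<Longrightarrow> ord_eq (n + m) (f * g)"
  by (auto simp: ord_eq_def)

lemma ord_eq_power3: "ord_eq n f \<Longrightarrow> ord_eq (3 * n) (f ^ 3)"
  by (auto simp: ord_eq_def fls_subdegree_pow)

lemma ord_eq_inverse: "ord_eq n f \<Longrightarrow> ord_eq (- n) (1 / f)"
  by (auto simp: ord_eq_def fls_divide_subdegree)

lemma ord_eq_add: "ord_eq n f \<Longrightarrow> ord_ge m g \<Longrightarrow> n < m \<Longrightarrow> ord_eq n (f + g)"
  using fls_subdegree_eqI[of "f + g" n] fls_nonzeroI[of "f + g" n] nth_fls_subdegree_nonzero[of f]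
  by (auto simp: ord_eq_def ord_ge_iff_nth)

lemma ord_ge_cancel: "ord_eq n g \<Longrightarrow> ord_ge m (f * g) \<Longrightarrow> ord_ge (m - n) f"
  unfolding ord_ge_def ord_eq_def by (cases "f = 0") auto

lemma ord_ge_unbounded_imp_zero:
  assumes "\<And>n::nat. ord_ge (int n) f"
  shows "f = 0"
  using assms[of "nat (fls_subdegree f + 1)"] by (auto simp: ord_ge_def split: if_splits)

lemma ord_ge_const: "ord_ge 0 (fls_const c)"
  by (simp add: ord_ge_def)

lemma ord_eq_const: "c \<noteq> 0 \<Longrightarrow> ord_eq 0 (fls_const c)"
  by (simp add: ord_eq_def)

lemma ord_eq_X_inv: "ord_eq (- 1) fls_X_inv"
  by (simp add: ord_eq_def)

lemma F_plus_iff: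
  assumes "q > 1"
  shows "f \<in> F_plus q \<longleftrightarrow> f \<noteq> 0 \<and> fls_subdegree f < 0"
proof -
  have "q powi (- n) > 1 \<longleftrightarrow> n < 0" for n
  proof (cases "n < 0")
    case False
    then have "q powi n \<ge> 1"
      using assms by (intro one_le_power_int) auto
    with False show ?thesis
      by (simp add: power_int_minus inverse_le_1_iff not_less)
  qed (use assms in \<open>auto intro: one_less_power_int\<close>)
  then show ?thesis
    by (simp add: F_plus_def abs_T_def)
qed

section \<open>Embedding of polynomials in T\<close>

lemma poly_T_0 [simp]: "poly_T 0 = 0"
  by (simp add: poly_T_def)

lemma poly_T_pCons [simp]: "poly_T (pCons c p) = fls_const c + fls_X_inv * poly_T p"
  by (simp add: poly_T_def map_poly_pCons)

lemma poly_T_1 [simp]: "poly_T 1 = 1"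
  by (simp add: one_pCons)

lemma poly_T_add [simp]: "poly_T (p + q) = poly_T p + poly_T q"
  by (induction p q rule: poly_induct2) (simp_all add: algebra_simps flip: fls_plus_const)

lemma poly_T_smult [simp]: "poly_T (smult c p) = fls_const c * poly_T p"
  by (induction p) (simp_all add: algebra_simps)

lemma poly_T_mult [simp]: "poly_T (p * q) = poly_T p * poly_T q"
  by (induction p) (simp_all add: algebra_simps)

lemma ord_eq_poly_T: "p \<noteq> 0 \<Longrightarrow> ord_eq (- int (degree p)) (poly_T p)"
proof (induction p)
  case (pCons c p)
  show ?case
  proof (cases "p = 0")
    case True
    with pCons show ?thesis by (simp add: ord_eq_const)
  next
    case False
    have "ord_eq (- 1 + - int (degree p)) (fls_X_inv * poly_T p)"
      using False pCons.IH by (intro ord_eq_mult ord_eq_X_inv) auto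
    from ord_eq_add[OF this ord_ge_const[of c]] show ?thesis
      using False by (simp add: add.commute)
  qed
qed simp

lemma ord_ge_poly_T: "degree p \<le> n \<Longrightarrow> ord_ge (- int n) (poly_T p)"
  using ord_eq_poly_T[of p] ord_eq_imp_ge[of _ "poly_T p" "- int n"]
  by (cases "p = 0") (auto simp: ord_ge_def)

section \<open>Limits of Laurent series\<close>

lemma tendsto_fls_if_ord_ge:
  fixes s :: "nat \<Rightarrow> 'a::field fls"
  assumes "\<And>n. ord_ge (int n) (L - s n)"
  shows "s \<longlonglongrightarrow> L"
proof (rule tendstoI)
  fix e :: real
  assume "e > 0"
  then obtain N where N: "(1 / 2) ^ N < e"
    using real_arch_pow_inv[of e "1 / 2"] by auto
  have "dist (s n) L < e" if "n \<ge> N" for n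
  proof -
    have "dist (s n) L \<le> (1 / 2) ^ n"
    proof (cases "s n = L")
      case False
      then have n: "int n \<le> fls_subdegree (s n - L)"
        using assms[of n] by (simp add: ord_ge_def fls_subdegree_minus_sym)
      then have "dist (s n) L = (1 / 2) ^ nat (fls_subdegree (s n - L))"
        using False by (simp add: dist_fls_def power_one_over inverse_eq_divide)
      also have "\<dots> \<le> (1 / 2) ^ n"
        using n by (intro power_decreasing) auto
      finally show ?thesis .
    qed simp
    also have "\<dots> \<le> (1 / 2) ^ N"
      using that by (intro power_decreasing) auto
    finally show ?thesis using N by simp
  qed
  then show "\<forall>\<^sub>F n in sequentially. dist (s n) L < e"
    by (auto simp: eventually_sequentially)
qed

text \<open>The coefficient at index i is stable from \<open>s (nat (i + 1))\<close> on, so the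
  limit can be written down as a diagonal series.\<close>

lemma fls_convergent_if_ord_ge:
  fixes s :: "nat \<Rightarrow> 'a::field fls"
  assumes "\<And>n. ord_ge (int n) (s (Suc n) - s n)"
  shows "ord_ge (int n) (lim s - s n)"
proof -
  define L where "L = Abs_fls (\<lambda>i. fls_nth (s (nat (i + 1))) i)"
  \<comment> \<open>For negative i the index \<open>nat (i + 1)\<close> is 0: these coefficients
    come from \<open>s 0\<close> and vanish below its subdegree.\<close>
  have L: "fls_nth L i = fls_nth (s (nat (i + 1))) i" for i
    unfolding L_def
    by (subst nth_Abs_fls_lower_bound[of "min 0 (fls_subdegree (s 0))"]) auto
  have stable: "fls_nth (s (n + j)) i = fls_nth (s n) i" if "i < int n" for i n j
  proof (induction j)
    case (Suc j)
    show ?case using assms[of "n + j"] that Suc by (simp add: ord_ge_iff_nth)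
  qed simp
  have ge: "ord_ge (int n) (L - s n)" for n
    unfolding ord_ge_iff_nth
  proof (intro allI impI)
    fix i assume i: "i < int n"
    show "fls_nth (L - s n) i = 0"
      using stable[of i "nat (i + 1)" "n - nat (i + 1)"] i
      by (cases "i < 0") (use stable[of i 0 n] in \<open>auto simp: L\<close>)
  qed
  have "lim s = L"
    by (rule limI[OF tendsto_fls_if_ord_ge[OF ge]])
  with ge show ?thesis by simp
qed

section \<open>Continued fractions\<close>

locale continued_fraction =
  fixes a :: "nat \<Rightarrow> 'a::field poly"
  assumes degree_pos: "n \<ge> 1 \<Longrightarrow> degree (a n) \<ge> 1"
begin

definition tail :: "nat \<Rightarrow> 'a fls" where
  "tail i = lim (fin_cf a i)"

lemma inf_cf_eq_tail: "inf_cf a = tail 1"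
  by (simp add: inf_cf_def tail_def)

lemma ord_eq_partial_quotient: "i \<ge> 1 \<Longrightarrow> ord_eq (- int (degree (a i))) (poly_T (a i))"
  using degree_pos[of i] by (intro ord_eq_poly_T) auto

lemma ord_eq_fin_cf: "i \<ge> 1 \<Longrightarrow> ord_eq (- int (degree (a i))) (fin_cf a i n)"
proof (induction n arbitrary: i)
  case (Suc n)
  show ?case
    using ord_eq_add[OF ord_eq_partial_quotient ord_eq_imp_ge[OF ord_eq_inverse[OF Suc.IH[of "Suc i"]], of 0]]
      Suc.prems degree_pos[of i] by simp
qed (simp add: ord_eq_partial_quotient)

text \<open>\<open>1 / f - 1 / g\<close> is \<open>g - f\<close> times
  \<open>1 / f * (1 / g)\<close>, which has order at least 2. This gain drives the
  convergence.\<close>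

lemma ord_ge_inverse_diff:
  assumes "ord_eq n f" "ord_eq n g" "n \<le> - 1" "ord_ge m (f - g)"
  shows "ord_ge (m + 2) (1 / f - 1 / g)"
proof -
  have nz: "f \<noteq> 0" "g \<noteq> 0"
    using assms by (auto simp: ord_eq_def)
  have "ord_eq (- n + - n) (1 / f * (1 / g))"
    using assms by (intro ord_eq_mult ord_eq_inverse)
  from ord_ge_mult[OF ord_ge_minus_commute[OF assms(4)] ord_eq_imp_ge[OF this order_refl]]
  have "ord_ge (m + (- n + - n)) ((g - f) * (1 / f * (1 / g)))" .
  also have "(g - f) * (1 / f * (1 / g)) = 1 / f - 1 / g"
    using nz by (simp add: field_simps)
  finally show ?thesis
    using assms(3) by (auto elim: ord_ge_mono)
qed

lemma ord_ge_fin_cf_Suc: "i \<ge> 1 \<Longrightarrow> ord_ge (int n) (fin_cf a i (Suc n) - fin_cf a i n)"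
proof (induction n arbitrary: i)
  case 0
  then show ?case
    using ord_eq_imp_ge[OF ord_eq_inverse[OF ord_eq_fin_cf[of "Suc i" 0]], of 0] by simp
next
  case (Suc n)
  have "ord_ge (int n + 2) (1 / fin_cf a (Suc i) (Suc n) - 1 / fin_cf a (Suc i) n)"
    using degree_pos[of "Suc i"] Suc.prems
    by (intro ord_ge_inverse_diff[OF ord_eq_fin_cf ord_eq_fin_cf] Suc.IH) auto
  then show ?case
    by (auto elim: ord_ge_mono)
qed

lemma ord_ge_tail: "i \<ge> 1 \<Longrightarrow> ord_ge (int n) (tail i - fin_cf a i n)"
  unfolding tail_def by (intro fls_convergent_if_ord_ge ord_ge_fin_cf_Suc)

lemma ord_eq_tail: "i \<ge> 1 \<Longrightarrow> ord_eq (- int (degree (a i))) (tail i)"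
  using ord_eq_add[OF ord_eq_fin_cf[of i 0] ord_ge_tail[of i 0]] degree_pos[of i] by simp

lemma tail_nonzero: "i \<ge> 1 \<Longrightarrow> tail i \<noteq> 0"
  using ord_eq_tail[of i] by (simp add: ord_eq_def)

text \<open>Both sides agree with \<open>fin_cf a i (Suc n)\<close> up to order n, for every
  n.\<close>

lemma tail_rec:
  assumes "i \<ge> 1"
  shows "tail i = poly_T (a i) + 1 / tail (Suc i)"
proof -
  have "ord_ge (int n) (tail i - (poly_T (a i) + 1 / tail (Suc i)))" for n
  proof -
    have "ord_ge (int n) (tail i - fin_cf a i (Suc n))"
      by (rule ord_ge_mono[OF ord_ge_tail]) (use assms in auto)
    moreover have "ord_ge (int n) (1 / tail (Suc i) - 1 / fin_cf a (Suc i) n)"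
      by (rule ord_ge_mono[OF ord_ge_inverse_diff[OF ord_eq_tail ord_eq_fin_cf _ ord_ge_tail]])
        (use degree_pos[of "Suc i"] in auto)
    ultimately have "ord_ge (int n) (tail i - fin_cf a i (Suc n)
        - (1 / tail (Suc i) - 1 / fin_cf a (Suc i) n))"
      by (rule ord_ge_diff)
    then show ?thesis
      by (simp add: algebra_simps)
  qed
  then have "tail i - (poly_T (a i) + 1 / tail (Suc i)) = 0"
    by (rule ord_ge_unbounded_imp_zero)
  then show ?thesis by simp
qed

lemma tail_mult_tail: "i \<ge> 1 \<Longrightarrow> tail i * tail (Suc i) = poly_T (a i) * tail (Suc i) + 1"
  using tail_rec[of i] tail_nonzero[of "Suc i"] by (simp add: field_simps)

lemma tail_continuants:
  assumes "n \<ge> 1"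
  shows "tail 1 * (poly_T (cont_y a n) * tail (Suc n) + poly_T (cont_y a (n - 1)))
    = poly_T (cont_x a n) * tail (Suc n) + poly_T (cont_x a (n - 1))"
  using assms
proof (induction n rule: nat_induct_at_least)
  case base
  then show ?case using tail_mult_tail[of 1] by (simp add: numeral_2_eq_2)
next
  case (Suc n)
  obtain j where j: "n = Suc j" using Suc.hyps by (cases n) auto
  \<comment> \<open>By \<open>tail_mult_tail\<close> each bracket is
    \<open>tail (Suc (Suc n))\<close> times the bracket of the induction hypothesis. The factor
    \<open>tail (Suc n)\<close> is cancelled at the end.\<close>
  have "tail (Suc n) * (tail 1 * (poly_T (cont_y a (Suc n)) * tail (Suc (Suc n)) + poly_T (cont_y a n)))
      = tail (Suc n) * (poly_T (cont_x a (Suc n)) * tail (Suc (Suc n)) + poly_T (cont_x a n))"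
    using Suc.IH tail_mult_tail[of "Suc n"] unfolding j by simp algebra
  then show ?case
    using tail_nonzero[of "Suc n"] by simp
qed

end

section \<open>Degrees of continuants for linear partial quotients\<close>

lemma degree_continuant_step:
  fixes p :: "'a::field poly"
  assumes "degree p = 1" "degree q = n" "q \<noteq> 0" "degree r \<le> n"
  shows "degree (p * q + r) = Suc n \<and> p * q + r \<noteq> 0"
proof -
  have "degree (p * q) = Suc n"
    using assms by (subst degree_mult_eq) auto
  then have "degree (p * q + r) = Suc n"
    using assms by (simp add: degree_add_eq_left)
  then show ?thesis by auto
qed

lemma degree_cont_x:
  assumes "\<And>n. n \<ge> 1 \<Longrightarrow> degree (a n) = 1"
  shows "degree (cont_x a n) = n \<and> cont_x a n \<noteq> 0"
proof (induction n rule: induct_nat_012)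
  case 1
  then show ?case using assms[of 1] by auto
next
  case (ge2 n)
  then show ?case using degree_continuant_step[of "a (Suc (Suc n))"] assms by simp
qed simp

lemma degree_cont_y:
  assumes "\<And>n. n \<ge> 1 \<Longrightarrow> degree (a n) = 1"
  shows "degree (cont_y a (Suc n)) = n \<and> cont_y a (Suc n) \<noteq> 0"
proof (induction n rule: induct_nat_012)
  case 1
  then show ?case using assms[of 2] by (auto simp: numeral_2_eq_2)
next
  case (ge2 n)
  then show ?case using degree_continuant_step[of "a (Suc (Suc (Suc n)))"] assms by simp
qed simp

section \<open>Cubing in characteristic 3 and blocks of three partial quotients\<close>

lemma cube_add:
  fixes x y :: "'a::comm_ring_1"
  assumes "(3::'a) = 0"
  shows "(x + y) ^ 3 = x ^ 3 + y ^ 3"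
proof -
  have "(x + y) ^ 3 = x ^ 3 + y ^ 3 + 3 * (x ^ 2 * y + x * y ^ 2)"
    by (simp add: algebra_simps power3_eq_cube power2_eq_square)
  with assms show ?thesis by simp
qed

text \<open>
  Working backwards from \<open>\<beta>\<^sub>3\<close>, each step multiplies by the denominator of the previous one, so that no
  denominator has to be known to be nonzero.
\<close>

lemma three_quotients_constant:
  fixes T :: "'a::field"
  assumes "c * c = 1" "L * L = 1"
    and "\<beta>2 * \<beta>3 = c * L * T * \<beta>3 + 1" "\<beta>1 * \<beta>2 = c * L * T * \<beta>2 + 1"
    and "\<beta>0 * \<beta>1 = c * L * T * \<beta>1 + 1"
    and "g = c * (T ^ 2 + 1) * \<beta>3 + L * T"
  shows "c * (T ^ 2 + 1) * \<beta>0 * g = (L * T ^ 3 + L * T) * g + (L * T * g + 1)"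
proof -
  \<comment> \<open>\<open>g - L * T\<close> is \<open>c * (T ^ 2 + 1) * \<beta>3\<close>; the terms
    in \<open>T ^ 2\<close> cancel because \<open>L * L = 1\<close>.\<close>
  have 2: "\<beta>2 * (g - L * T) = c * (L * T * g + 1)"
    using assms by algebra
  have 1: "\<beta>1 * (L * T * g + 1) = c * (T ^ 2 + 1) * g"
    using assms(1,2,4) 2 by algebra
  show ?thesis
    using assms(1,2,5) 1 by algebra
qed

text \<open>The same elimination works because in characteristic 3 the product of
  \<open>L * T + M\<close> and \<open>L * T - M\<close> is \<open>T ^ 2 - 1\<close>, that is,
  \<open>T ^ 2 + 1\<close> increased by 1.\<close>

lemma three_quotients_sign_change:
  fixes T :: "'a::field"
  assumes "(3::'a) = 0" "c * c = 1" "L * L = 1" "M * M = 1"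
    and "\<beta>2 * \<beta>3 = - (c * L * T + c * M) * \<beta>3 + 1" "\<beta>1 * \<beta>2 = (c * L * T - c * M) * \<beta>2 + 1"
    and "\<beta>0 * \<beta>1 = c * L * T * \<beta>1 + 1"
    and "g = c * (T ^ 2 + 1) * \<beta>3 - L * T + M"
  shows "c * (T ^ 2 + 1) * \<beta>0 * g = (L * T ^ 3 + L * T) * g + ((L * T + M) * g + 1)"
proof -
  have "(L * T + M) * (L * T - M) = L * L * T ^ 2 - M * M"
    by (simp add: algebra_simps power2_eq_square)
  also have "\<dots> = T ^ 2 + 1 + 1 - 3"
    using assms(3,4) by simp
  finally have norm: "T ^ 2 + 1 = (L * T + M) * (L * T - M) - 1"
    using assms(1) by simp
  have 2: "\<beta>2 * (g + L * T - M) = - c * ((L * T + M) * g + 1)"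
    using assms(2,5,8) norm by algebra
  have 1: "\<beta>1 * ((L * T + M) * g + 1) = c * (T ^ 2 + 1) * g"
    using assms(2,6) norm 2 by algebra
  show ?thesis
    using assms(2,3,7) 1 by algebra
qed

section \<open>The relation between cubes and complete quotients\<close>

lemma fls_char3: "(3::'a::field) = 0 \<Longrightarrow> (3::'a fls) = 0"
  by (metis fls_const_0 fls_const_numeral)

context continued_fraction
begin

text \<open>
  The two alternatives of the hypothesis \<open>step\<close> are a block without and with a sign change.  If \<open>g\<close>
  is the value that \<open>tail (n + 1) ^ 3\<close> should have, then the defect at \<open>n\<close> is \<open>1 / tail (n + 1) ^ 3 - 1 / g\<close>,
  so a defect gains order 6 at each step backwards.
\<close>

lemma cube_step:
  fixes lam mu f :: "nat \<Rightarrow> 'a" and c :: 'a and K n :: nat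
  defines "E \<equiv> \<lambda>n. fls_const c * (fls_X_inv ^ 2 + 1) * tail (3 * n + K)
    + fls_const (lam n) * fls_X_inv + fls_const (f n)"
  assumes char3: "(3::'a) = 0"
    and pq: "a n = [:mu n, lam n:]"
    and sq: "c * c = 1" "lam n * lam n = 1" "mu n ^ 3 = mu n"
    and deg: "degree (a (3 * (n + 1) + K)) = 1" "degree (a (n + 1)) = 1"
    and n: "n \<ge> 1"
    and step: "lam (n + 1) = lam n \<and> f n = mu n \<and> f (n + 1) = 0
        \<and> a (3 * n + K) = [:0, c * lam n:] \<and> a (3 * n + K + 1) = [:0, c * lam n:]
        \<and> a (3 * n + K + 2) = [:0, c * lam n:]
      \<or> lam (n + 1) = - lam n \<and> f n = 0 \<and> f (n + 1) = mu n \<and> mu n * mu n = 1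
        \<and> a (3 * n + K) = [:0, c * lam n:] \<and> a (3 * n + K + 1) = [:- (c * mu n), c * lam n:]
        \<and> a (3 * n + K + 2) = [:- (c * mu n), - (c * lam n):]"
    and ge: "ord_ge i (tail (n + 1) ^ 3 - E (n + 1))"
  shows "ord_ge (i + 6) (tail n ^ 3 - E n)"
proof -
  let ?T = "fls_X_inv :: 'a fls"
  define C L M where "C = fls_const c" and "L = fls_const (lam n)" and "M = fls_const (mu n)"
  define F F' L' where "F = fls_const (f n)" and "F' = fls_const (f (n + 1))"
    and "L' = fls_const (lam (n + 1))"
  define \<beta>0 \<beta>1 \<beta>2 \<beta>3 where "\<beta>0 = tail (3 * n + K)" and "\<beta>1 = tail (3 * n + K + 1)"
    and "\<beta>2 = tail (3 * n + K + 2)" and "\<beta>3 = tail (3 * n + K + 3)"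
  define G where "G = tail (n + 1) ^ 3"
  define g where "g = C * (?T ^ 2 + 1) * \<beta>3 + L' * ?T + F'"
  note char3' = fls_char3[OF char3]
  have E: "E n = C * (?T ^ 2 + 1) * \<beta>0 + L * ?T + F" "E (n + 1) = g"
    by (simp_all add: E_def C_def L_def F_def \<beta>0_def g_def \<beta>3_def L'_def F'_def add.commute
        add.left_commute)
  have CL: "C * C = 1" "L * L = 1"
    using sq by (simp_all add: C_def L_def)
  have M3: "M ^ 3 = M"
    using sq(3) by (simp add: M_def flip: fls_const_power)
  have \<beta>: "\<beta>2 * \<beta>3 = poly_T (a (3 * n + K + 2)) * \<beta>3 + 1"
    "\<beta>1 * \<beta>2 = poly_T (a (3 * n + K + 1)) * \<beta>2 + 1"
    "\<beta>0 * \<beta>1 = poly_T (a (3 * n + K)) * \<beta>1 + 1"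
    using tail_mult_tail[of "3 * n + K + 2"] tail_mult_tail[of "3 * n + K + 1"]
      tail_mult_tail[of "3 * n + K"] n
    by (simp_all add: \<beta>0_def \<beta>1_def \<beta>2_def \<beta>3_def eval_nat_numeral)
  \<comment> \<open>\<open>tail n ^ 3\<close> satisfies this equation with
    \<open>tail (n + 1) ^ 3\<close> for \<open>g\<close>. Of the three copies of
    \<open>L * T * g\<close> that cancel, two come from the block and one from the linear term of
    \<open>E n\<close>.\<close>
  have Eg: "E n * g = (L * ?T ^ 3 + M) * g + 1"
    using step
  proof (elim disjE conjE)
    assume h: "lam (n + 1) = lam n" "f n = mu n" "f (n + 1) = 0"
      "a (3 * n + K) = [:0, c * lam n:]" "a (3 * n + K + 1) = [:0, c * lam n:]"
      "a (3 * n + K + 2) = [:0, c * lam n:]"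
    have p: "poly_T [:0, c * lam n:] = C * L * ?T"
      by (simp add: C_def L_def mult.commute)
    have e: "L' = L" "F = M" "F' = 0"
      using h by (simp_all add: L'_def L_def F_def M_def F'_def)
    have "C * (?T ^ 2 + 1) * \<beta>0 * g = (L * ?T ^ 3 + L * ?T) * g + (L * ?T * g + 1)"
      by (rule three_quotients_constant[OF CL \<beta>[unfolded h p]]) (simp add: g_def e)
    then have "E n * g = (L * ?T ^ 3 + M) * g + 1 + 3 * (L * ?T * g)"
      by (simp add: E e algebra_simps)
    then show ?thesis by (simp add: char3')
  next
    assume h: "lam (n + 1) = - lam n" "f n = 0" "f (n + 1) = mu n" "mu n * mu n = 1"
      "a (3 * n + K) = [:0, c * lam n:]" "a (3 * n + K + 1) = [:- (c * mu n), c * lam n:]"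
      "a (3 * n + K + 2) = [:- (c * mu n), - (c * lam n):]"
    have p: "poly_T [:0, c * lam n:] = C * L * ?T"
      "poly_T [:- (c * mu n), c * lam n:] = C * L * ?T - C * M"
      "poly_T [:- (c * mu n), - (c * lam n):] = - (C * L * ?T + C * M)"
      by (simp_all add: C_def L_def M_def mult.commute)
    have e: "L' = - L" "F = 0" "F' = M"
      using h by (simp_all add: L'_def L_def F_def M_def F'_def)
    have MM: "M * M = 1" by (simp add: M_def h)
    have "C * (?T ^ 2 + 1) * \<beta>0 * g = (L * ?T ^ 3 + L * ?T) * g + ((L * ?T + M) * g + 1)"
      by (rule three_quotients_sign_change[OF char3' CL MM \<beta>[unfolded h p]]) (simp add: g_def e)
    then have "E n * g = (L * ?T ^ 3 + M) * g + 1 + 3 * (L * ?T * g)"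
      by (simp add: E e algebra_simps)
    then show ?thesis by (simp add: char3')
  qed
  have "tail n * tail (n + 1) = (M + L * ?T) * tail (n + 1) + 1"
    using tail_mult_tail[OF n] by (simp add: pq M_def L_def mult.commute)
  \<comment> \<open>Cubing is additive and fixes the coefficients \<open>L\<close> and
    \<open>M\<close>.\<close>
  then have "(tail n * tail (n + 1)) ^ 3 = ((M + L * ?T) * tail (n + 1) + 1) ^ 3"
    by simp
  also have "\<dots> = (M ^ 3 + L ^ 3 * ?T ^ 3) * G + 1"
    by (simp add: cube_add[OF char3'] power_mult_distrib G_def)
  also have "L ^ 3 = L"
    using CL by (simp add: power3_eq_cube)
  finally have G: "tail n ^ 3 * G = (L * ?T ^ 3 + M) * G + 1"
    by (simp add: M3 G_def power_mult_distrib add.commute)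
  have ordG: "ord_eq (- 3) G"
    using ord_eq_power3[OF ord_eq_tail[of "n + 1"]] deg by (simp add: G_def)
  have "c \<noteq> 0" using sq by auto
  have "ord_eq (- 1 + - 1) (?T * ?T)"
    by (intro ord_eq_mult ord_eq_X_inv)
  then have ordQ: "ord_eq (- 2) (?T ^ 2 + 1)"
    using ord_eq_add[of "- 2" "?T * ?T" 0 1] by (simp add: power2_eq_square ord_ge_def)
  have "ord_eq (0 + - 2 + - 1) (C * (?T ^ 2 + 1) * \<beta>3)"
    using deg ord_eq_tail[of "3 * (n + 1) + K"] \<open>c \<noteq> 0\<close>
    by (intro ord_eq_mult ordQ) (auto simp: C_def ord_eq_const \<beta>3_def add.commute add.left_commute)
  moreover have "ord_ge (- 1) (L' * ?T + F')"
    using ord_ge_mult[OF ord_ge_const ord_eq_imp_ge[OF ord_eq_X_inv order_refl]]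
    by (intro ord_ge_add) (auto simp: L'_def F'_def ord_ge_def)
  ultimately have ordg: "ord_eq (- 3) g"
    using ord_eq_add[of "- 3" "C * (?T ^ 2 + 1) * \<beta>3" "- 1" "L' * ?T + F'"]
    by (simp add: g_def add.assoc)
  \<comment> \<open>Multiplying by \<open>g * G\<close>, of order -6, leaves the negative of the
    defect at \<open>n + 1\<close>.\<close>
  have "(tail n ^ 3 - E n) * (g * G) = (tail n ^ 3 * G) * g - (E n * g) * G"
    by (simp add: algebra_simps)
  also have "\<dots> = - (G - g)"
    unfolding Eg G by (simp add: algebra_simps)
  finally have "ord_ge i ((tail n ^ 3 - E n) * (g * G))"
    using ge by (simp only: E(2) G_def ord_ge_uminus)
  from ord_ge_cancel[OF ord_eq_mult[OF ordg ordG] this] show ?thesis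
    by simp
qed

text \<open>Every term of a defect has order at least -3. Going through \<open>cube_step\<close> j
  times raises the bound to \<open>6 * j - 3\<close>, for every j, so the defect is zero.\<close>

lemma cube_relation:
  fixes lam mu f :: "nat \<Rightarrow> 'a" and c :: 'a and K n :: nat
  assumes char3: "(3::'a) = 0"
    and pq: "\<And>n. n \<ge> 1 \<Longrightarrow> a n = [:mu n, lam n:]"
    and sq: "c * c = 1" "\<And>n. n \<ge> 1 \<Longrightarrow> lam n * lam n = 1" "\<And>n. n \<ge> 1 \<Longrightarrow> mu n ^ 3 = mu n"
    and step: "\<And>n. n \<ge> 1 \<Longrightarrow> lam (n + 1) = lam n \<and> f n = mu n \<and> f (n + 1) = 0
        \<and> a (3 * n + K) = [:0, c * lam n:] \<and> a (3 * n + K + 1) = [:0, c * lam n:]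
        \<and> a (3 * n + K + 2) = [:0, c * lam n:]
      \<or> lam (n + 1) = - lam n \<and> f n = 0 \<and> f (n + 1) = mu n \<and> mu n * mu n = 1
        \<and> a (3 * n + K) = [:0, c * lam n:] \<and> a (3 * n + K + 1) = [:- (c * mu n), c * lam n:]
        \<and> a (3 * n + K + 2) = [:- (c * mu n), - (c * lam n):]"
    and n: "n \<ge> 1"
  shows "tail n ^ 3 = fls_const c * (fls_X_inv ^ 2 + 1) * tail (3 * n + K)
    + fls_const (lam n) * fls_X_inv + fls_const (f n)"
proof -
  define E where "E n = fls_const c * (fls_X_inv ^ 2 + 1) * tail (3 * n + K)
    + fls_const (lam n) * fls_X_inv + fls_const (f n)" for n
  have deg: "degree (a n) = 1" if "n \<ge> 1" for n
    using pq[OF that] sq(2)[OF that] by auto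
  \<comment> \<open>The bound is proved for all n at once, since the one at n uses the one at n +
    1.\<close>
  have ord: "ord_ge (6 * int j - 3) (tail n ^ 3 - E n)" if "n \<ge> 1" for j n
    using that
  proof (induction j arbitrary: n)
    case 0
    have T: "ord_eq (- 1) (tail n)" "ord_eq (- 1) (tail (3 * n + K))"
      using ord_eq_tail[of n] ord_eq_tail[of "3 * n + K"] 0 deg by auto
    have X2: "ord_ge (- 2) (fls_X_inv ^ 2 + 1 :: 'a fls)"
      using ord_ge_mult[OF ord_eq_imp_ge ord_eq_imp_ge, OF ord_eq_X_inv order_refl ord_eq_X_inv order_refl]
      by (intro ord_ge_add) (auto simp: power2_eq_square ord_ge_def)
    have "ord_ge (0 + - 2 + - 1) (fls_const c * (fls_X_inv ^ 2 + 1) * tail (3 * n + K))"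
      by (intro ord_ge_mult ord_ge_const X2 ord_eq_imp_ge[OF T(2)] order_refl)
    moreover have "ord_ge (0 + - 1) (fls_const (lam n) * fls_X_inv)"
      by (intro ord_ge_mult ord_ge_const ord_eq_imp_ge[OF ord_eq_X_inv] order_refl)
    moreover have "ord_ge (- 3) (tail n ^ 3)"
      by (rule ord_eq_imp_ge[OF ord_eq_power3[OF T(1)]]) simp
    ultimately show ?case
      unfolding E_def by (intro ord_ge_diff ord_ge_add) (auto elim: ord_ge_mono simp: ord_ge_def)
  next
    case (Suc j)
    have "ord_ge (6 * int j - 3) (tail (n + 1) ^ 3 - E (n + 1))"
      using Suc.IH[of "n + 1"] by simp
    from cube_step[where n = n and lam = lam and mu = mu and f = f and c = c and K = K,
        OF char3 pq[OF Suc.prems] sq(1) sq(2,3)[OF Suc.prems] deg deg Suc.prems step[OF Suc.prems]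
          this[unfolded E_def]]
    have "ord_ge (6 * int j - 3 + 6) (tail n ^ 3 - E n)"
      unfolding E_def by simp
    then show ?case by (simp add: algebra_simps)
  qed
  have "tail n ^ 3 - E n = 0"
  proof (rule ord_ge_unbounded_imp_zero)
    fix j :: nat
    show "ord_ge (int j) (tail n ^ 3 - E n)"
      by (rule ord_ge_mono[OF ord[OF n, of "Suc j"]]) simp
  qed
  then show ?thesis by (simp add: E_def)
qed

end

text \<open>The difference of two fixed points times both denominators is the determinant
  \<open>A * D - B * C\<close> times \<open>X ^ 3 - Y ^ 3\<close>, which is
  \<open>(X - Y) ^ 3\<close>. The orders of the two sides are incompatible.\<close>

lemma moebius_cube_fixed_point_unique:
  fixes A B C D X Y :: "'a::field fls" and l :: int
  assumes char3: "(3::'a) = 0"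
    and ord: "ord_eq (- l) A" "ord_ge (3 - l) B" "ord_eq (1 - l) C" "ord_ge (4 - l) D"
    and X: "X = (A * X ^ 3 + B) / (C * X ^ 3 + D)" "X \<noteq> 0" "fls_subdegree X < 0"
    and Y: "Y = (A * Y ^ 3 + B) / (C * Y ^ 3 + D)" "Y \<noteq> 0" "fls_subdegree Y < 0"
  shows "X = Y"
proof (rule ccontr)
  assume "X \<noteq> Y"
  \<comment> \<open>The terms with \<open>Z ^ 3\<close> dominate, so numerator and denominator
    differ in order by exactly 1.\<close>
  have main: "ord_eq (- 1) Z \<and> ord_eq (- 2 - l) (C * Z ^ 3 + D)"
    if Z: "Z = (A * Z ^ 3 + B) / (C * Z ^ 3 + D)" "Z \<noteq> 0" "fls_subdegree Z < 0" for Z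
  proof -
    define d where "d = fls_subdegree Z"
    have d: "ord_eq d Z" using Z by (simp add: ord_eq_def d_def)
    have num: "ord_eq (- l + 3 * d) (A * Z ^ 3 + B)"
      by (rule ord_eq_add[OF ord_eq_mult[OF ord(1) ord_eq_power3[OF d]] ord(2)])
        (use Z(3) d_def in auto)
    have den: "ord_eq (1 - l + 3 * d) (C * Z ^ 3 + D)"
      by (rule ord_eq_add[OF ord_eq_mult[OF ord(3) ord_eq_power3[OF d]] ord(4)])
        (use Z(3) d_def in auto)
    have "ord_eq (- l + 3 * d + - (1 - l + 3 * d)) Z"
      using ord_eq_mult[OF num ord_eq_inverse[OF den]] Z(1) by simp
    with d have "d = - 1" by (simp add: ord_eq_def)
    with d den show ?thesis by simp
  qed
  note mX = main[OF X] and mY = main[OF Y]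
  define d where "d = fls_subdegree (X - Y)"
  have d: "ord_eq d (X - Y)"
    using \<open>X \<noteq> Y\<close> by (simp add: ord_eq_def d_def)
  have "ord_ge (- 1) (X - Y)"
    using mX mY by (intro ord_ge_diff) (auto elim: ord_eq_imp_ge)
  with d have "d \<ge> - 1" by (auto simp: ord_ge_def ord_eq_def)
  have eq: "X * (C * X ^ 3 + D) = A * X ^ 3 + B" "Y * (C * Y ^ 3 + D) = A * Y ^ 3 + B"
    using X(1) Y(1) mX mY by (auto simp: ord_eq_def nonzero_eq_divide_eq)
  have "(X - Y) * ((C * X ^ 3 + D) * (C * Y ^ 3 + D))
      = X * (C * X ^ 3 + D) * (C * Y ^ 3 + D) - Y * (C * Y ^ 3 + D) * (C * X ^ 3 + D)"
    by (simp add: algebra_simps)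
  also have "\<dots> = (A * D - B * C) * (X ^ 3 - Y ^ 3)"
    unfolding eq by (simp add: algebra_simps)
  also have "X ^ 3 - Y ^ 3 = (X - Y) ^ 3"
    using cube_add[OF fls_char3[OF char3], of "X - Y" Y] by simp
  finally have id: "(X - Y) * ((C * X ^ 3 + D) * (C * Y ^ 3 + D)) = (A * D - B * C) * (X - Y) ^ 3" .
  have "ord_ge (4 - 2 * l) (A * D - B * C)"
  proof (intro ord_ge_diff)
    show "ord_ge (4 - 2 * l) (A * D)"
      using ord_ge_mult[OF ord_eq_imp_ge[OF ord(1) order_refl] ord(4)] by (rule ord_ge_mono) simp
    show "ord_ge (4 - 2 * l) (B * C)"
      using ord_ge_mult[OF ord(2) ord_eq_imp_ge[OF ord(3) order_refl]] by (rule ord_ge_mono) simp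
  qed
  from ord_ge_mult[OF this ord_eq_imp_ge[OF ord_eq_power3[OF d] order_refl]]
  have "ord_ge (4 - 2 * l + 3 * d) ((X - Y) * ((C * X ^ 3 + D) * (C * Y ^ 3 + D)))"
    by (simp only: id)
  moreover have "ord_eq (d + ((- 2 - l) + (- 2 - l))) ((X - Y) * ((C * X ^ 3 + D) * (C * Y ^ 3 + D)))"
    using mX mY by (intro ord_eq_mult d) auto
  \<comment> \<open>This gives \<open>d \<le> - 4\<close>, against
    \<open>d \<ge> - 1\<close>.\<close>
  ultimately have "4 - 2 * l + 3 * d \<le> d + ((- 2 - l) + (- 2 - l))"
    unfolding ord_ge_def ord_eq_def by metis
  with \<open>d \<ge> - 1\<close> show False by simp
qed

section \<open>The partial quotients of omega\<close>

text \<open>If x is neither 0 nor 1, then \<open>x + 1\<close> is neither 1 nor x, so the field is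
  {0, 1, -1}. Likewise \<open>1 + 1\<close> can only be -1.\<close>

lemma field_CARD_3:
  assumes "CARD('a::field) = 3"
  shows "(3::'a) = 0" "\<And>x::'a. x \<noteq> 0 \<Longrightarrow> x * x = 1"
proof -
  have fin: "finite (UNIV :: 'a set)"
    using assms by (simp add: card_ge_0_finite)
  have "\<exists>x::'a. x \<notin> {0, 1}"
  proof (rule ccontr)
    assume "\<not> ?thesis"
    then have "(UNIV :: 'a set) = {0, 1}" by auto
    with assms show False by (metis card_2_iff numeral_eq_iff semiring_norm(89) zero_neq_one)
  qed
  then obtain x :: 'a where x: "x \<noteq> 0" "x \<noteq> 1" by auto
  then have "card {0, 1, x} = CARD('a)"
    using assms by auto
  then have UNIV: "UNIV = {0, 1, x}"
    using card_subset_eq[OF fin] by blast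
  have mem: "y = 0 \<or> y = 1 \<or> y = x" for y :: 'a
    using UNIV UNIV_I[of y] by blast
  have x': "x = - 1"
    using mem[of "x + 1"] x by (auto simp: eq_neg_iff_add_eq_0)
  have "(1::'a) + 1 \<noteq> 1"
    by (metis add.right_neutral add_left_cancel zero_neq_one)
  then have "(1::'a) + 1 + 1 = 0"
    using mem[of "1 + 1"] x x' by (auto simp: eq_neg_iff_add_eq_0 simp del: one_add_one)
  then show "(3::'a) = 0"
    by simp
  show "y * y = 1" if "y \<noteq> 0" for y :: 'a
    using mem[of y] that x' by auto
qed

section \<open>Positions of the sign changes\<close>

locale omega_parameters =
  fixes m :: nat and k :: "nat \<Rightarrow> nat"
  assumes m: "m \<ge> 1" and k1: "k 1 \<ge> 2"
    and k_gap: "\<And>i. 1 \<le> i \<Longrightarrow> i < m \<Longrightarrow> k (i + 1) \<ge> k i + 2"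
begin

text \<open>The \<open>t\<^bsub>i,n\<^esub>\<close> in increasing order, as a single sequence indexed by \<open>j = n m + (i - 1)\<close>.\<close>

definition tau :: "nat \<Rightarrow> nat" where
  "tau j = t_idx m k (j mod m + 1) (j div m)"

lemma tau_index: "1 \<le> i \<Longrightarrow> i \<le> m \<Longrightarrow> tau (n * m + (i - 1)) = t_idx m k i n"
  by (cases i) (simp_all add: tau_def)

text \<open>Powers of 3 are odd, so the \<open>div\<close> is exact; its value triples and grows by
  1, which contributes \<open>k m\<close>.\<close>

lemma t_idx_Suc: "t_idx m k i (Suc n) = 3 * t_idx m k i n + k m"
proof -
  have "odd (3 ^ n :: nat)" by simp
  then obtain h where "3 ^ n = 2 * h + (1::nat)" by (elim oddE)
  then show ?thesis by (simp add: t_idx_def algebra_simps)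
qed

lemma tau_add_m: "tau (j + m) = 3 * tau j + k m"
  using m by (simp add: tau_def t_idx_Suc)

lemma tau_0: "tau 0 = k 1"
  by (simp add: tau_def t_idx_def)

lemma tau_m: "tau (m - 1) = k m"
  using tau_index[of m 0] m by (simp add: t_idx_def)

lemma tau_Suc: "tau j + 2 \<le> tau (Suc j)"
proof -
  define n where "n = j div m"
  have "odd (3 ^ n :: nat)" by simp
  then obtain h where h: "3 ^ n = 2 * h + (1::nat)" by (elim oddE)
  \<comment> \<open>At the end of a level the gap is \<open>k 1 * 3 ^ (n + 1)\<close>, otherwise
    \<open>(k (i + 1) - k i) * 3 ^ n\<close>.\<close>
  show ?thesis
  proof (cases "Suc (j mod m) = m")
    case True
    have "tau j = k m * (3 * h + 1)"
      using True h by (simp add: tau_def t_idx_def algebra_simps flip: n_def)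
    moreover have "tau (Suc j) = k m * (3 * h + 1) + k 1 * (3 * 3 ^ n)"
      using True h by (simp add: tau_def t_idx_def mod_Suc div_Suc algebra_simps flip: n_def)
    moreover have "2 * 1 \<le> k 1 * (3 * 3 ^ n)"
      using k1 by (intro mult_mono) auto
    ultimately show ?thesis by simp
  next
    case False
    define i where "i = j mod m + 1"
    have i: "1 \<le> i" "i < m"
      using False m by (simp_all add: i_def Suc_lessI)
    have "tau j = k m * h + k i * 3 ^ n" "tau (Suc j) = k m * h + k (i + 1) * 3 ^ n"
      using False h by (simp_all add: tau_def t_idx_def mod_Suc div_Suc i_def flip: n_def)
    moreover have "(k i + 2) * 3 ^ n \<le> k (i + 1) * 3 ^ n"
      using k_gap[OF i] by (rule mult_right_mono) simp
    moreover have "1 \<le> (3 ^ n :: nat)"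
      by simp
    ultimately show ?thesis
      unfolding add_mult_distrib by linarith
  qed
qed

lemma tau_less: "i < j \<Longrightarrow> tau i + 2 \<le> tau j"
proof (induction j)
  case (Suc j)
  then show ?case using tau_Suc[of j] by (cases "i = j") auto
qed simp

lemma tau_less_iff: "tau i < tau j \<longleftrightarrow> i < j"
  using tau_less[of i j] tau_less[of j i] by (cases i j rule: linorder_cases) auto

lemma tau_eq_iff: "tau i = tau j \<longleftrightarrow> i = j"
  using tau_less[of i j] tau_less[of j i] by (cases i j rule: linorder_cases) auto

lemma tau_ge_2: "tau j \<ge> 2"
  using k1 tau_0 tau_less[of 0 j] by (cases "j = 0") auto

lemma Suc_tau_neq_tau: "Suc (tau i) \<noteq> tau j"
  using tau_less[of i j] tau_less[of j i] by (cases i j rule: linorder_cases) auto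

lemma tau_interval_exists:
  assumes "tau 0 < t"
  obtains j where "tau j < t" "t \<le> tau (Suc j)"
proof -
  have "\<exists>j. tau j < t \<and> t \<le> tau (Suc j)" if "t \<le> tau n" for n
    using that
  proof (induction n)
    case (Suc n)
    then show ?case by (cases "t \<le> tau n") (auto simp: not_le)
  qed (use assms in simp)
  moreover have "n \<le> tau n" for n
  proof (induction n)
    case (Suc n)
    then show ?case using tau_Suc[of n] by simp
  qed simp
  ultimately show ?thesis using that by blast
qed

lemma tau_interval_unique:
  assumes "tau i < t" "t \<le> tau (Suc i)" "tau j < t" "t \<le> tau (Suc j)"
  shows "i = j"
proof -
  have "tau i < tau (Suc j)" "tau j < tau (Suc i)"
    using assms by auto
  then show ?thesis by (simp add: tau_less_iff)
qed

text \<open>As \<open>k m\<close> is \<open>tau (m - 1)\<close>, such an s has index at least m and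
  \<open>tau_add_m\<close> applies. Later sign changes thus lie in one residue class modulo
  3.\<close>

lemma tau_above_k_m:
  assumes "s > k m" "s \<in> range tau"
  shows "\<exists>j. s = 3 * tau j + k m"
proof -
  obtain i where i: "s = tau i" using assms by auto
  with assms(1) have "m - 1 < i"
    by (simp add: tau_less_iff flip: tau_m)
  with tau_add_m[of "i - m"] i show ?thesis
    by (intro exI[of _ "i - m"]) auto
qed

section \<open>Signs of the leading coefficients\<close>

abbreviation lam :: "nat \<Rightarrow> 'a::field" where "lam \<equiv> lambda_seq m k"

lemma lam_le: "t \<le> tau 0 \<Longrightarrow> lam t = 1"
  by (simp add: lambda_seq_def tau_0 t_idx_def)

text \<open>With \<open>j = n * m + (i - 1)\<close>, the exponent \<open>m * n + i\<close>, and for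
  i = m the exponent \<open>m * (n + 1)\<close>, is \<open>j + 1\<close>.\<close>

lemma lam_interval:
  assumes "tau j < t" "t \<le> tau (Suc j)"
  shows "lam t = ((- 1) ^ (j + 1) :: 'a::field)"
proof -
  define P where "P c n \<longleftrightarrow> (\<exists>i. 1 \<le> i \<and> i < m \<and> t_idx m k i n < t \<and> t \<le> t_idx m k (i + 1) n
          \<and> c = (-1) ^ (m * n + i))
       \<or> (t_idx m k m n < t \<and> t \<le> t_idx m k 1 (n + 1) \<and> c = (-1) ^ (m * (n + 1)))"
    for c :: 'a and n
  have P: "P c n \<Longrightarrow> \<exists>j. tau j < t \<and> t \<le> tau (Suc j) \<and> c = (- 1) ^ (j + 1)" for c n
    unfolding P_def
  proof (elim disjE exE conjE)
    fix i assume i: "1 \<le> i" "i < m" "t_idx m k i n < t" "t \<le> t_idx m k (i + 1) n"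
      "c = (- 1) ^ (m * n + i)"
    have "Suc (n * m + (i - 1)) = n * m + (i + 1 - 1)" using i by simp
    with i tau_index[of i n] tau_index[of "i + 1" n] show ?thesis
      by (intro exI[of _ "n * m + (i - 1)"]) (auto simp: mult.commute)
  next
    assume i: "t_idx m k m n < t" "t \<le> t_idx m k 1 (n + 1)" "c = (- 1) ^ (m * (n + 1))"
    have "Suc (n * m + (m - 1)) = (n + 1) * m + (1 - 1)" using m by simp
    with i m tau_index[of m n] tau_index[of 1 "n + 1"] show ?thesis
      by (intro exI[of _ "n * m + (m - 1)"]) (auto simp: mult.commute add.commute)
  qed
  have "P ((- 1) ^ (j + 1)) (j div m)"
  proof (cases "Suc (j mod m) = m")
    case True
    have "Suc j = m * (j div m) + Suc (j mod m)"
      by simp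
    then have "Suc j = m * (j div m + 1)"
      using True by simp
    then show ?thesis
      using True assms by (simp add: P_def tau_def mod_Suc div_Suc)
  next
    case False
    have "Suc j = m * (j div m) + (j mod m + 1)" by simp
    moreover have "j mod m + 1 < m"
      using False m by (simp add: Suc_lessI)
    ultimately show ?thesis
      using False assms by (auto simp: P_def tau_def mod_Suc div_Suc intro!: exI[of _ "j mod m + 1"])
  qed
  then have "(THE c. \<exists>n. P c n) = (- 1) ^ (j + 1)"
    by (intro the_equality) (use P tau_interval_unique[OF _ _ assms] in blast)+
  moreover have "\<not> t \<le> t_idx m k 1 0"
    using assms(1) tau_less_iff[of 0 j] tau_0 by (cases "j = 0") (auto simp: t_idx_def)
  ultimately show ?thesis
    by (simp add: lambda_seq_def P_def)
qed

lemma lam_Suc_const: "t \<notin> range tau \<Longrightarrow> lam (Suc t) = (lam t :: 'a::field)"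
proof (cases "t \<le> tau 0")
  case True
  moreover assume "t \<notin> range tau"
  ultimately have "Suc t \<le> tau 0" by (metis le_eq_less_or_eq rangeI Suc_leI)
  with True show ?thesis by (simp add: lam_le)
next
  case False
  moreover assume t: "t \<notin> range tau"
  ultimately obtain j where j: "tau j < t" "t \<le> tau (Suc j)"
    using tau_interval_exists[of t] by auto
  with t have "Suc t \<le> tau (Suc j)" by (metis le_eq_less_or_eq rangeI Suc_leI)
  with j show ?thesis
    using lam_interval[of j t, where 'a = 'a] lam_interval[of j "Suc t", where 'a = 'a] by simp
qed

lemma lam_Suc_tau: "lam (Suc (tau j)) = (- lam (tau j) :: 'a::field)"
proof -
  have "lam (Suc (tau j)) = ((- 1) ^ (j + 1) :: 'a)"
    using tau_Suc[of j] by (intro lam_interval) auto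
  moreover have "lam (tau j) = ((- 1) ^ j :: 'a)"
  proof (cases j)
    case (Suc i)
    then show ?thesis using tau_Suc[of i] lam_interval[of i "tau j", where 'a = 'a] by simp
  qed (simp add: lam_le)
  ultimately show ?thesis by simp
qed

lemma lam_1: "lam 1 = 1"
  using tau_ge_2[of 0] by (intro lam_le) auto

lemma lam_square: "t \<ge> 1 \<Longrightarrow> lam t * lam t = (1 :: 'a::field)"
proof (induction t rule: nat_induct_at_least)
  case base
  show ?case by (simp only: lam_1 mult_1_left)
next
  case (Suc t)
  then show ?case
    by (cases "t \<in> range tau") (auto simp: lam_Suc_tau lam_Suc_const)
qed

text \<open>The first three positions lie above \<open>k m\<close> in the wrong class modulo 3. Only
  \<open>3 * n + k m\<close> can be a sign change, and only if \<open>n\<close> is one.\<close>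

lemma not_in_range_tau:
  assumes "n \<ge> 1"
  shows "3 * n + k m - 2 \<notin> range tau" "3 * n + k m - 1 \<notin> range tau" "Suc (3 * n + k m) \<notin> range tau"
    "n \<notin> range tau \<Longrightarrow> 3 * n + k m \<notin> range tau"
proof -
  have above: "k m < 3 * n + k m - 2" "k m < 3 * n + k m - 1" "k m < Suc (3 * n + k m)"
    using assms by linarith+
  have mod3: "3 * n + k m - 2 \<noteq> 3 * i + k m" "3 * n + k m - 1 \<noteq> 3 * i + k m"
    "Suc (3 * n + k m) \<noteq> 3 * i + k m" for i
    using assms by presburger+
  show "3 * n + k m - 2 \<notin> range tau" "3 * n + k m - 1 \<notin> range tau" "Suc (3 * n + k m) \<notin> range tau"
    using tau_above_k_m[OF above(1)] tau_above_k_m[OF above(2)] tau_above_k_m[OF above(3)] mod3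
    by blast+
  show "3 * n + k m \<notin> range tau" if "n \<notin> range tau"
  proof
    assume "3 * n + k m \<in> range tau"
    from tau_above_k_m[OF _ this] assms obtain j where "3 * n + k m = 3 * tau j + k m" by auto
    with that show False by auto
  qed
qed

text \<open>From \<open>3 * n + k m - 1\<close> on, the sign can only change after
  \<open>3 * n + k m\<close>, and does so exactly if it changes after \<open>n\<close>. The last
  conclusion is \<open>first\<close> for \<open>n + 1\<close>, which makes this an induction
  step.\<close>

lemma lam_triple_from_first:
  assumes n: "n \<ge> 1" and first: "lam (3 * n + k m - 1) = (- 1) ^ m * (lam n :: 'a::field)"
  shows "lam (3 * n + k m) = (- 1) ^ m * (lam n :: 'a)"
    and "lam (Suc (3 * n + k m)) = (- 1) ^ m * (lam (Suc n) :: 'a)"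
    and "lam (Suc (Suc (3 * n + k m))) = (- 1) ^ m * (lam (Suc n) :: 'a)"
proof -
  show 1: "lam (3 * n + k m) = (- 1) ^ m * (lam n :: 'a)"
    using lam_Suc_const[OF not_in_range_tau(2)[OF n], where 'a = 'a] first n by simp
  show 2: "lam (Suc (3 * n + k m)) = (- 1) ^ m * (lam (Suc n) :: 'a)"
  proof (cases "n \<in> range tau")
    case True
    then obtain j where "n = tau j" by auto
    then show ?thesis
      using 1 by (simp add: lam_Suc_tau flip: tau_add_m)
  next
    case False
    then show ?thesis
      using 1 not_in_range_tau(4)[OF n] by (simp add: lam_Suc_const)
  qed
  show "lam (Suc (Suc (3 * n + k m))) = (- 1) ^ m * (lam (Suc n) :: 'a)"
    using 2 not_in_range_tau(3)[OF n] by (simp add: lam_Suc_const)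
qed

lemma lam_triple_first:
  assumes "n \<ge> 1"
  shows "lam (3 * n + k m - 1) = (- 1) ^ m * (lam n :: 'a::field)"
  using assms
proof (induction n rule: nat_induct_at_least)
  case base
  have "tau m = 3 * tau 0 + k m"
    using tau_add_m[of 0] by simp
  \<comment> \<open>\<open>k m + 2\<close> lies between \<open>tau (m - 1) = k m\<close> and
    \<open>tau m = 3 * k 1 + k m\<close>.\<close>
  then have "lam (Suc (Suc (k m))) = ((- 1) ^ m :: 'a)"
    using lam_interval[of "m - 1" "Suc (Suc (k m))"] tau_m m tau_ge_2[of 0] by simp
  moreover have "3 * 1 + k m - 1 = Suc (Suc (k m))"
    by simp
  ultimately show ?case
    by (simp only: lam_1 mult_1_right)
next
  case (Suc n)
  have "3 * Suc n + k m - 1 = Suc (Suc (3 * n + k m))"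
    by simp
  with lam_triple_from_first(3)[OF Suc] show ?case
    by (simp only:)
qed

section \<open>Constant terms of the partial quotients\<close>

abbreviation mu :: "(nat \<Rightarrow> 'a::field) \<Rightarrow> nat \<Rightarrow> 'a" where "mu \<eta> \<equiv> mu_seq m \<eta> k"

text \<open>Gaps of at least 2 let t determine j, and j determines n and i; so the definite
  description has a single candidate.\<close>

lemma mu_tau:
  assumes "t = tau j \<or> t = Suc (tau j)"
  shows "mu \<eta> t = (- 1) ^ (j div m * (m + 1)) * \<eta> (j mod m + 1)"
proof -
  define P where "P n i \<longleftrightarrow> 1 \<le> i \<and> i \<le> m \<and> (t = t_idx m k i n \<or> t = t_idx m k i n + 1)"
    for n i
  have P: "P (j div m) (j mod m + 1)"
    using assms m by (auto simp: P_def tau_def Suc_le_eq)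
  have unique: "n = j div m \<and> i = j mod m + 1" if "P n i" for n i
  proof -
    have i: "1 \<le> i" "i \<le> m" and t: "t = tau (n * m + (i - 1)) \<or> t = Suc (tau (n * m + (i - 1)))"
      using that by (auto simp: P_def tau_index[symmetric])
    have "j = n * m + (i - 1)"
      using t assms
      by (auto simp: tau_eq_iff Suc_tau_neq_tau Suc_tau_neq_tau[symmetric])
    with i show ?thesis
      by (cases i) auto
  qed
  have "t \<noteq> 1"
    using assms tau_ge_2[of j] by auto
  moreover have "(THE c. \<exists>n i. P n i \<and> c = (- 1) ^ (n * (m + 1)) * \<eta> i)
      = (- 1) ^ (j div m * (m + 1)) * \<eta> (j mod m + 1)"
    using P unique by (intro the_equality) blast+
  ultimately show ?thesis
    using P by (auto simp: mu_seq_def P_def conj_assoc)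
qed

lemma mu_eq_0:
  assumes "t > 1" "t \<notin> range tau" "t - 1 \<notin> range tau"
  shows "mu \<eta> t = 0"
proof -
  have "\<not> (1 \<le> i \<and> i \<le> m \<and> (t = t_idx m k i n \<or> t = t_idx m k i n + 1))" for n i
    using assms by (auto simp: tau_index[symmetric])
  then have 2: "\<not> (\<exists>n i. 1 \<le> i \<and> i \<le> m \<and> (t = t_idx m k i n \<or> t = t_idx m k i n + 1))"
    by blast
  have 1: "t \<noteq> 1"
    using assms(1) by simp
  show ?thesis
    unfolding mu_seq_def if_not_P[OF 1] if_not_P[OF 2] ..
qed

text \<open>Raising n by one at the same i brings the factor \<open>(- 1) ^ (m + 1)\<close>, written
  here in the form that \<open>cube_step\<close> requires.\<close>

lemma mu_tau_add_m:
  "mu \<eta> (tau (j + m)) = - ((- 1) ^ m * mu \<eta> (tau j))"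
  using m mu_tau[of "tau (j + m)" "j + m" \<eta>] mu_tau[of "tau j" j \<eta>] by (simp add: power_add)

end

context omega_parameters
begin

text \<open>
  The constant term \<open>f\<^sub>n\<close> in the relation between \<open>\<alpha>\<^sub>n\<^sup>3\<close> and a later complete quotient: a sign change at
  \<open>t = t\<^bsub>i,n\<^esub>\<close> leaves \<open>\<mu>\<^sub>t\<close> behind, which the equal \<open>\<mu>\<^bsub>t+1\<^esub>\<close> then absorbs.
\<close>

definition offset :: "(nat \<Rightarrow> 'a::field) \<Rightarrow> nat \<Rightarrow> 'a" where
  "offset \<eta> n = (if n = 1 \<or> n - 1 \<in> range tau then mu \<eta> n else 0)"

text \<open>This supplies the hypothesis \<open>step\<close> of \<open>cube_relation\<close>. With
  \<open>K = k m - 1\<close> the block is centred at \<open>3 * n + k m\<close>, and it contains a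
  sign change exactly if \<open>n\<close> is one.\<close>

lemma omega_pq_step:
  fixes \<eta> :: "nat \<Rightarrow> 'a::field" and n :: nat
  defines "a \<equiv> omega_pq m \<eta> k" and "c \<equiv> (- 1) ^ m" and "K \<equiv> k m - 1"
  assumes sq: "\<And>i. 1 \<le> i \<Longrightarrow> i \<le> m \<Longrightarrow> \<eta> i * \<eta> i = 1" and n: "n \<ge> 1"
  shows "lam (n + 1) = (lam n :: 'a) \<and> offset \<eta> n = mu \<eta> n \<and> offset \<eta> (n + 1) = 0
        \<and> a (3 * n + K) = [:0, c * lam n:] \<and> a (3 * n + K + 1) = [:0, c * lam n:]
        \<and> a (3 * n + K + 2) = [:0, c * lam n:]
      \<or> lam (n + 1) = - (lam n :: 'a) \<and> offset \<eta> n = 0 \<and> offset \<eta> (n + 1) = mu \<eta> n \<and> mu \<eta> n * mu \<eta> n = 1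
        \<and> a (3 * n + K) = [:0, c * lam n:] \<and> a (3 * n + K + 1) = [:- (c * mu \<eta> n), c * lam n:]
        \<and> a (3 * n + K + 2) = [:- (c * mu \<eta> n), - (c * lam n):]"
proof -
  have km: "k m \<ge> 2"
    using tau_ge_2[of "m - 1"] tau_m by simp
  have idx: "3 * n + K = 3 * n + k m - 1" "3 * n + K + 1 = 3 * n + k m" "3 * n + K + 2 = Suc (3 * n + k m)"
    using km by (simp_all add: K_def)
  note first = lam_triple_first[OF n, where 'a = 'a]
  note lams = first lam_triple_from_first[OF n first]
  note out = not_in_range_tau[OF n]
  have mu_first: "mu \<eta> (3 * n + k m - 1) = 0"
  proof (rule mu_eq_0)
    show "3 * n + k m - 1 - 1 \<notin> range tau"
      using out(1) by (simp add: diff_diff_left numeral_2_eq_2)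
  qed (use out n km in auto)
  show ?thesis
  proof (cases "n \<in> range tau")
    case True
    then obtain j where j: "n = tau j" by auto
    \<comment> \<open>Sign changes are never adjacent, so none at \<open>n - 1\<close> leaves a
      constant at \<open>n\<close>.\<close>
    have "n - 1 \<notin> range tau"
    proof
      assume "n - 1 \<in> range tau"
      then obtain i where "n - 1 = tau i" by auto
      then show False using Suc_tau_neq_tau[of i j] j n by simp
    qed
    moreover have "n \<noteq> 1"
      using j tau_ge_2[of j] by simp
    ultimately have "offset \<eta> n = 0"
      by (simp add: offset_def)
    moreover have mu_Suc: "mu \<eta> (Suc (tau i)) = mu \<eta> (tau i)" for i
      using mu_tau[of "Suc (tau i)" i \<eta>] mu_tau[of "tau i" i \<eta>] by simp
    moreover have "offset \<eta> (n + 1) = mu \<eta> n"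
      using j mu_Suc[of j] by (simp add: offset_def)
    moreover have "mu \<eta> n * mu \<eta> n = 1"
    proof -
      have "\<eta> (j mod m + 1) * \<eta> (j mod m + 1) = 1"
        using m by (intro sq) (auto simp: Suc_le_eq)
      moreover have "((- 1) ^ p * x) * ((- 1) ^ p * x) = x * x" for p and x :: 'a
      proof -
        have "((- 1) ^ p * x) * ((- 1) ^ p * x) = ((- 1) ^ p * (- 1) ^ p) * (x * x)"
          by (simp only: mult_ac)
        then show ?thesis
          by (simp flip: power_mult_distrib)
      qed
      ultimately show ?thesis
        using mu_tau[of n j \<eta>] j by (simp only: simp_thms)
    qed
    moreover have "mu \<eta> (3 * n + k m) = - (c * mu \<eta> n)"
      using mu_tau_add_m[of \<eta> j] j by (simp add: tau_add_m c_def)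
    moreover have "mu \<eta> (Suc (3 * n + k m)) = mu \<eta> (3 * n + k m)"
      using mu_Suc[of "j + m"] j by (simp add: tau_add_m)
    ultimately show ?thesis
      using lams mu_first lam_Suc_tau[of j, where 'a = 'a] j
      \<comment> \<open>The longer indices go first because \<open>3 * n + K\<close> is a subterm of
        them.\<close>
      unfolding idx(2,3) unfolding idx(1) by (simp add: a_def omega_pq_def c_def)
  next
    case False
    note out4 = out(4)[OF False]
    \<comment> \<open>At n = 1 this is the special case in \<open>offset\<close>; for larger n both
      sides are 0.\<close>
    have "offset \<eta> n = mu \<eta> n"
      using False n mu_eq_0[of n \<eta>] by (cases "n = 1") (auto simp: offset_def)
    moreover have "offset \<eta> (n + 1) = 0"
      using False n by (simp add: offset_def)
    moreover have "mu \<eta> (3 * n + k m) = 0"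
      using out(2) out4 n km by (intro mu_eq_0) auto
    moreover have "mu \<eta> (Suc (3 * n + k m)) = 0"
      using out(3) out4 n km by (intro mu_eq_0) auto
    ultimately show ?thesis
      using lams mu_first lam_Suc_const[OF False, where 'a = 'a]
      unfolding idx(2,3) unfolding idx(1) by (simp add: a_def omega_pq_def c_def)
  qed
qed

end

section \<open>The quartic equation and the uniqueness of its root\<close>

theorem mainTheorem1:
  fixes m l :: nat and \<eta> :: "nat \<Rightarrow> 'a::field" and k :: "nat \<Rightarrow> nat" and q :: real
  assumes "CARD('a) = 3"
    and "q > 1"
    and "m \<ge> 1"
    and "\<forall>i\<in>{1..m}. \<eta> i \<noteq> 0"
    and "\<eta> m = (-1) ^ (m - 1)"
    and "k 1 \<ge> 2"
    and "\<forall>i\<in>{1..<m}. k (i + 1) \<ge> k i + 2"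
    and "l = 1 + k m"
  shows "omega m \<eta> k \<in> F_plus q
    \<and> quartic_eq m l (omega_pq m \<eta> k) (omega m \<eta> k)
    \<and> (\<forall>X \<in> F_plus q. quartic_eq m l (omega_pq m \<eta> k) X \<longrightarrow> X = omega m \<eta> k)"
proof -
  interpret omega_parameters m k
    using assms by unfold_locales auto
  note char3 = field_CARD_3(1)[OF assms(1)]
  note unit_square = field_CARD_3(2)[OF assms(1)]
  define a where "a = omega_pq m \<eta> k"
  have deg: "degree (a n) = 1" if "n \<ge> 1" for n
    using lam_square[OF that, where 'a = 'a] by (auto simp: a_def omega_pq_def)
  interpret cf: continued_fraction a
    by unfold_locales (simp add: deg)
  let ?T = "fls_X_inv :: 'a fls"
  define \<alpha> \<beta> where "\<alpha> = cf.tail 1" and "\<beta> = cf.tail (Suc l)"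
  have omega: "omega m \<eta> k = \<alpha>"
    by (simp add: omega_def \<alpha>_def cf.inf_cf_eq_tail flip: a_def)
  have \<alpha>_ord: "ord_eq (- 1) \<alpha>" and \<beta>_ord: "ord_eq (- 1) \<beta>"
    using cf.ord_eq_tail[of 1] cf.ord_eq_tail[of "Suc l"] deg by (simp_all add: \<alpha>_def \<beta>_def)
  \<comment> \<open>\<open>e\<close> is both \<open>\<eta> m\<close> and the sign in the equation;
    the sign in \<open>cube_relation\<close> is \<open>- e\<close>.\<close>
  define e where "e = ((- 1) ^ (m - 1) :: 'a)"
  have e: "(- 1) ^ m = - e" "e * e = 1"
    using m by (cases m; simp add: e_def flip: power_mult_distrib)+
  have e_fls: "(- 1) ^ (m - 1) = fls_const e"
    by (simp add: e_def fls_const_power)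
  have km: "k m \<ge> 2"
    using tau_ge_2[of "m - 1"] tau_m by simp
  \<comment> \<open>So \<open>l - 3\<close> is a genuine difference, namely
    \<open>j\<close>.\<close>
  then obtain j where j: "l = Suc (Suc (Suc j))"
    using assms(8) by (metis add_2_eq_Suc le_Suc_ex plus_1_eq_Suc)
  define x y where "x i = poly_T (cont_x a i)" and "y i = poly_T (cont_y a i)" for i

  have rel: "\<alpha> ^ 3 = fls_const ((- 1) ^ m) * (?T ^ 2 + 1) * cf.tail (3 * 1 + (k m - 1))
      + fls_const (lam 1) * ?T + fls_const (offset \<eta> 1)"
    unfolding \<alpha>_def
  proof (rule cf.cube_relation[OF char3])
    show "a n = [:mu \<eta> n, lam n:]" for n
      by (simp add: a_def omega_pq_def)
    show "mu \<eta> n ^ 3 = mu \<eta> n" for n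
      using unit_square[of "mu \<eta> n"] by (cases "mu \<eta> n = 0") (simp_all add: power3_eq_cube)
  next
    fix n :: nat assume "n \<ge> 1"
    then show "lam (n + 1) = (lam n :: 'a) \<and> offset \<eta> n = mu \<eta> n \<and> offset \<eta> (n + 1) = 0
        \<and> a (3 * n + (k m - 1)) = [:0, (- 1) ^ m * lam n:]
        \<and> a (3 * n + (k m - 1) + 1) = [:0, (- 1) ^ m * lam n:]
        \<and> a (3 * n + (k m - 1) + 2) = [:0, (- 1) ^ m * lam n:]
      \<or> lam (n + 1) = - (lam n :: 'a) \<and> offset \<eta> n = 0 \<and> offset \<eta> (n + 1) = mu \<eta> n
        \<and> mu \<eta> n * mu \<eta> n = 1
        \<and> a (3 * n + (k m - 1)) = [:0, (- 1) ^ m * lam n:]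
        \<and> a (3 * n + (k m - 1) + 1) = [:- ((- 1) ^ m * mu \<eta> n), (- 1) ^ m * lam n:]
        \<and> a (3 * n + (k m - 1) + 2) = [:- ((- 1) ^ m * mu \<eta> n), - ((- 1) ^ m * lam n):]"
      unfolding a_def using assms(4) unit_square by (intro omega_pq_step) auto
  qed (use lam_square e in auto)
  have index: "3 * 1 + (k m - 1) = Suc l"
    using km assms(8) by simp
  have "offset \<eta> 1 = 1"
    by (simp add: offset_def mu_seq_def)
  then have cube: "\<alpha> ^ 3 = - fls_const e * (?T ^ 2 + 1) * \<beta> + ?T + 1"
    using rel unfolding index by (simp add: e(1) \<beta>_def lam_1[unfolded One_nat_def])

  \<comment> \<open>\<open>l - 1 = k m\<close> is the last sign change of level 0: both constants
    are \<open>\<eta> m\<close>, and the sign flips from \<open>e\<close> to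
    \<open>- e\<close>.\<close>
  have pq: "a (Suc (Suc j)) = [:e, e:]" "a l = [:e, - e:]"
  proof -
    have k: "Suc (Suc j) = tau (m - 1)" "l = Suc (tau (m - 1))"
      using tau_m j assms(8) by simp_all
    have "mu \<eta> (tau (m - 1)) = e" "mu \<eta> (Suc (tau (m - 1))) = e"
      using m assms(5) mu_tau[of "tau (m - 1)" "m - 1" \<eta>] mu_tau[of "Suc (tau (m - 1))" "m - 1" \<eta>]
      by (simp_all add: e_def)
    moreover have "lam (Suc (tau (m - 1))) = - e"
      using lam_interval[of "m - 1" "Suc (tau (m - 1))", where 'a = 'a] tau_Suc[of "m - 1"] m e(1)
      by simp
    moreover from this have "lam (tau (m - 1)) = e"
      by (simp add: lam_Suc_tau)
    ultimately show "a (Suc (Suc j)) = [:e, e:]" "a l = [:e, - e:]"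
      by (simp_all add: k a_def omega_pq_def)
  qed

  \<comment> \<open>\<open>z\<close> stands for either continuant. The recurrence run backwards
    expresses \<open>z (l - 3)\<close> through \<open>z l\<close> and \<open>z (l - 1)\<close>, and
    its term in \<open>z l\<close> cancels the summand \<open>T + 1\<close> of
    \<open>\<alpha> ^ 3\<close>.\<close>
  have reduce: "z l * \<alpha> ^ 3 + fls_const e * z (l - 3)
      = - fls_const e * (?T ^ 2 + 1) * (z l * \<beta> + z (l - 1))"
    if z: "z l = poly_T (a l) * z (l - 1) + z (l - 2)"
      "z (l - 1) = poly_T (a (l - 1)) * z (l - 2) + z (l - 3)" for z :: "nat \<Rightarrow> 'a fls"
  proof -
    define E where "E = fls_const e"
    have EE: "E * E = 1"
      by (simp add: E_def e)
    have "poly_T (a l) = E - ?T * E" "poly_T (a (l - 1)) = E + ?T * E"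
      unfolding pq(2) using pq(1) j by (simp_all add: E_def)
    note z' = z[unfolded this]
    have z3: "z (l - 3) = z (l - 1) - (E + ?T * E) * (z l - (E - ?T * E) * z (l - 1))"
      using z' by algebra
    have "E * z (l - 3) = - (?T + 1) * z l - E * (?T ^ 2 + 1) * z (l - 1) + 3 * (E * z (l - 1))"
      using EE unfolding z3 by algebra
    then have "E * z (l - 3) = - (?T + 1) * z l - E * (?T ^ 2 + 1) * z (l - 1)"
      by (simp add: fls_char3[OF char3])
    then show ?thesis
      by (simp add: cube flip: E_def) (simp add: algebra_simps)
  qed
  have x_rec: "x l * \<alpha> ^ 3 + fls_const e * x (l - 3) = - fls_const e * (?T ^ 2 + 1) * (x l * \<beta> + x (l - 1))"
    by (rule reduce) (simp_all add: x_def j numeral_2_eq_2 numeral_3_eq_3)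
  have y_rec: "y l * \<alpha> ^ 3 + fls_const e * y (l - 3) = - fls_const e * (?T ^ 2 + 1) * (y l * \<beta> + y (l - 1))"
    by (rule reduce) (simp_all add: y_def j numeral_2_eq_2 numeral_3_eq_3)

  have dx: "degree (cont_x a n) = n \<and> cont_x a n \<noteq> 0"
    and dy: "degree (cont_y a (Suc n)) = n \<and> cont_y a (Suc n) \<noteq> 0" for n
    using degree_cont_x[of a n] degree_cont_y[of a n] deg by auto
  have ord_e: "ord_eq 0 (fls_const e)"
    using e(2) by (intro ord_eq_const) auto
  have ord_x: "ord_eq (- int l) (x l)"
    using ord_eq_poly_T[of "cont_x a l"] dx[of l] by (simp add: x_def)
  have ord_y: "ord_eq (1 - int l) (y l)"
    using ord_eq_poly_T[of "cont_y a l"] dy[of "l - 1"] j by (simp add: y_def)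
  have "ord_ge (3 - int l) (x (l - 3))"
    using ord_ge_poly_T[of "cont_x a j" j] dx[of j] by (simp add: x_def j numeral_3_eq_3)
  then have ord_x3: "ord_ge (3 - int l) (fls_const e * x (l - 3))"
    using ord_ge_mult[OF ord_ge_const] by fastforce
  have "ord_ge (4 - int l) (y (l - 3))"
  proof (cases j)
    \<comment> \<open>For l = 3 the continuant is \<open>cont_y a 0 = 0\<close>, which has every
      order.\<close>
    case 0
    then show ?thesis by (simp add: y_def j ord_ge_def)
  next
    case (Suc i)
    then show ?thesis
      using ord_ge_poly_T[of "cont_y a j" i] dy[of i] by (simp add: y_def j numeral_3_eq_3)
  qed
  then have ord_y3: "ord_ge (4 - int l) (fls_const e * y (l - 3))"
    using ord_ge_mult[OF ord_ge_const] by fastforce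
  have "ord_eq (1 - int l + 3 * - 1) (y l * \<alpha> ^ 3 + fls_const e * y (l - 3))"
    by (rule ord_eq_add[OF ord_eq_mult[OF ord_y ord_eq_power3[OF \<alpha>_ord]] ord_y3]) simp
  then have den: "y l * \<alpha> ^ 3 + fls_const e * y (l - 3) \<noteq> 0"
    by (simp add: ord_eq_def)
  have "\<alpha> * (y l * \<beta> + y (l - 1)) = x l * \<beta> + x (l - 1)"
    using cf.tail_continuants[of l] j by (simp add: \<alpha>_def \<beta>_def x_def y_def)
  \<comment> \<open>The right sides of \<open>x_rec\<close> and \<open>y_rec\<close> share a factor,
    so the continuant identity carries over.\<close>
  then have "\<alpha> * (y l * \<alpha> ^ 3 + fls_const e * y (l - 3)) = x l * \<alpha> ^ 3 + fls_const e * x (l - 3)"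
    unfolding x_rec y_rec by (simp add: mult.left_commute)
  with den have root: "\<alpha> = (x l * \<alpha> ^ 3 + fls_const e * x (l - 3)) / (y l * \<alpha> ^ 3 + fls_const e * y (l - 3))"
    by (simp add: nonzero_eq_divide_eq)
  have quartic: "quartic_eq m l a X \<longleftrightarrow>
      X = (x l * X ^ 3 + fls_const e * x (l - 3)) / (y l * X ^ 3 + fls_const e * y (l - 3))" for X
    unfolding quartic_eq_def x_def y_def e_fls ..
  have \<alpha>: "\<alpha> \<noteq> 0" "fls_subdegree \<alpha> < 0"
    using \<alpha>_ord by (auto simp: ord_eq_def)
  show ?thesis
    unfolding omega a_def[symmetric] F_plus_iff[OF assms(2)] quartic
  proof (intro conjI ballI impI)
    fix X assume "X \<in> F_plus q"
      and "X = (x l * X ^ 3 + fls_const e * x (l - 3)) / (y l * X ^ 3 + fls_const e * y (l - 3))"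
    then show "X = \<alpha>"
      unfolding F_plus_iff[OF assms(2)]
      using moebius_cube_fixed_point_unique[OF char3 ord_x ord_x3 ord_y ord_y3 _ _ _ root \<alpha>] by blast
  qed (fact \<alpha> root)+
qed

end
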